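(* Let $R$ be a commutative ring with identity, $M$ an $R$-module, and let $a\in R$ be such that $$(0:_M a)\subseteq a\,\bigl(0:_M a\,Ann_R((0:_M a))\bigr).$$ If $(0:_M a)$ is a $\psi_1$-second submodule of $M$, then $(0:_M a)$ is a second submodule of $M$.
   Context: For a submodule $N$ of $M$ and an ideal $I$ of $R$, $(N:_M I)=\{m\in M: Im\subseteq N\}$; for $a\in R$, $(0:_M a)=\{m\in M: am=0\}$; $Ann_R(N)=\{r\in R: rN=0\}$. A non-zero submodule $N$ of $M$ is called second if for each $b\in R$ either $bN=N$ or $bN=0$. Let $S(M)$ be the set of submodules of $M$. For a function $\psi: S(M)\to S(M)\cup\{\emptyset\}$, a non-zero submodule $N$ of $M$ is $\psi$-second if for all $r\in R$ and all submodules $K$ of $M$ with $rN\subseteq K$ and $r\psi(N)\not\subseteq K$, one has $N\subseteq K$ or $rN=0$. The function $\psi_1$ is $\psi_1(N)=(N:_M Ann_R(N))$ for $N\in S(M)$. *)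

theory Defs
  imports "HOL-Algebra.Module" "HOL-Algebra.Coset"
begin

text \<open>
  Submodules are represented by their carrier sets. For \<open>a\<close> in \<open>R\<close> and a submodule
  \<open>N\<close> the set of all \<open>a n\<close> is already a submodule, so no span is taken in \<open>elt_smult\<close>.
\<close>

definition elt_smult :: "('a, 'b, 'm) module_scheme \<Rightarrow> 'a \<Rightarrow> 'b set \<Rightarrow> 'b set" where
  "elt_smult M a N = (\<lambda>n. a \<odot>\<^bsub>M\<^esub> n) ` N"

definition colon :: "('a, 'b, 'm) module_scheme \<Rightarrow> 'b set \<Rightarrow> 'a set \<Rightarrow> 'b set" where
  "colon M N I = {m \<in> carrier M. \<forall>r\<in>I. r \<odot>\<^bsub>M\<^esub> m \<in> N}"

definition zero_colon_elt :: "('a, 'b, 'm) module_scheme \<Rightarrow> 'a \<Rightarrow> 'b set" where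
  "zero_colon_elt M a = {m \<in> carrier M. a \<odot>\<^bsub>M\<^esub> m = \<zero>\<^bsub>M\<^esub>}"

definition Ann :: "('a, 'r) ring_scheme \<Rightarrow> ('a, 'b, 'm) module_scheme \<Rightarrow> 'b set \<Rightarrow> 'a set" where
  "Ann R M N = {r \<in> carrier R. \<forall>n\<in>N. r \<odot>\<^bsub>M\<^esub> n = \<zero>\<^bsub>M\<^esub>}"

definition second_submodule ::
  "('a, 'r) ring_scheme \<Rightarrow> ('a, 'b, 'm) module_scheme \<Rightarrow> 'b set \<Rightarrow> bool" where
  "second_submodule R M N \<longleftrightarrow>
     submodule N R M \<and> N \<noteq> {\<zero>\<^bsub>M\<^esub>} \<and>
     (\<forall>b\<in>carrier R. elt_smult M b N = N \<or> elt_smult M b N = {\<zero>\<^bsub>M\<^esub>})"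

text \<open>
  A function from submodules to submodules or the empty set is a total function on sets of
  which only the values at submodules matter; \<open>psi1_submodule\<close> below confirms that
  \<open>psi1 R M\<close> takes submodules to submodules.
\<close>

definition psi_second ::
  "('a, 'r) ring_scheme \<Rightarrow> ('a, 'b, 'm) module_scheme \<Rightarrow> ('b set \<Rightarrow> 'b set) \<Rightarrow> 'b set \<Rightarrow> bool"
  where
  "psi_second R M \<psi> N \<longleftrightarrow>
     submodule N R M \<and> N \<noteq> {\<zero>\<^bsub>M\<^esub>} \<and>
     (\<forall>r\<in>carrier R. \<forall>K. submodule K R M \<longrightarrow>
        elt_smult M r N \<subseteq> K \<longrightarrow> \<not> elt_smult M r (\<psi> N) \<subseteq> K \<longrightarrow>
        N \<subseteq> K \<or> elt_smult M r N = {\<zero>\<^bsub>M\<^esub>})"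

definition psi1 ::
  "('a, 'r) ring_scheme \<Rightarrow> ('a, 'b, 'm) module_scheme \<Rightarrow> 'b set \<Rightarrow> 'b set" where
  "psi1 R M N = colon M N (Ann R M N)"

lemma psi1_submodule:
  assumes "module R M" and N: "submodule N R M"
  shows "submodule (psi1 R M N) R M"
proof -
  interpret module R M by fact
  note E = submoduleE[OF N]
  have zN: "\<zero>\<^bsub>M\<^esub> \<in> N"
    using N by (simp add: submodule_def subgroup_def)
  show ?thesis
  proof (rule submoduleI)
    show "psi1 R M N \<subseteq> carrier M" "\<zero>\<^bsub>M\<^esub> \<in> psi1 R M N"
      using zN by (auto simp: psi1_def colon_def Ann_def)
    show "\<ominus>\<^bsub>M\<^esub> x \<in> psi1 R M N" if "x \<in> psi1 R M N" for x
      using that E(3) by (auto simp: psi1_def colon_def Ann_def smult_r_minus)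
    show "x \<oplus>\<^bsub>M\<^esub> y \<in> psi1 R M N" if "x \<in> psi1 R M N" "y \<in> psi1 R M N" for x y
      using that E(5) by (auto simp: psi1_def colon_def Ann_def smult_r_distr)
    show "r \<odot>\<^bsub>M\<^esub> x \<in> psi1 R M N" if "r \<in> carrier R" "x \<in> psi1 R M N" for r x
    proof -
      have "s \<odot>\<^bsub>M\<^esub> (r \<odot>\<^bsub>M\<^esub> x) \<in> N" if s: "s \<in> Ann R M N" for s
      proof -
        have c: "s \<in> carrier R" "x \<in> carrier M" "s \<odot>\<^bsub>M\<^esub> x \<in> N"
          using s \<open>x \<in> psi1 R M N\<close> by (auto simp: psi1_def colon_def Ann_def)
        have "s \<odot>\<^bsub>M\<^esub> (r \<odot>\<^bsub>M\<^esub> x) = r \<odot>\<^bsub>M\<^esub> (s \<odot>\<^bsub>M\<^esub> x)"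
          using c \<open>r \<in> carrier R\<close> by (metis smult_assoc1 R.m_comm)
        then show ?thesis using E(4) c \<open>r \<in> carrier R\<close> by simp
      qed
      then show ?thesis using that by (auto simp: psi1_def colon_def)
    qed
  qed
qed

end

theory Submission
  imports Defs
begin

text \<open>
  Let \<open>N\<close> be the kernel of \<open>a\<close> and \<open>P = (N : Ann N) = (0 : a Ann N)\<close>, so that the hypothesis
  reads \<open>N \<subseteq> a P\<close>. Given \<open>b\<close>, put \<open>K = b N\<close> and note \<open>(a + b) N = b N\<close>. If \<open>b P\<close> or
  \<open>(a + b) P\<close> is not contained in \<open>K\<close>, the \<open>\<psi>\<^sub>1\<close>-second property applies to \<open>b\<close> or \<open>a + b\<close>.
  Otherwise \<open>a P \<subseteq> K\<close>, as a difference of the two, and hence \<open>N \<subseteq> K\<close>.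
\<close>

context module
begin

text \<open>Since \<open>R\<close> is commutative, multiplication by \<open>b\<close> is an
  endomorphism of \<open>M\<close>, so it maps submodules to submodules. This allows
  \<open>b N\<close> itself to serve as the test submodule \<open>K\<close> in the definition of
  \<open>psi_second\<close>.\<close>

lemma submodule_elt_smult:
  assumes N: "submodule N R M" and b: "b \<in> carrier R"
  shows "submodule (elt_smult M b N) R M"
proof -
  note E = submoduleE[OF N]
  have sub: "n \<in> carrier M" if "n \<in> N" for n
    using that E(1) by blast
  have zN: "\<zero>\<^bsub>M\<^esub> \<in> N"
    using N by (simp add: submodule_def subgroup_def)
  show ?thesis
  proof (rule submoduleI)
    show "elt_smult M b N \<subseteq> carrier M"
      using b sub by (auto simp: elt_smult_def)
    show "\<zero>\<^bsub>M\<^esub> \<in> elt_smult M b N"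
      using b zN by (metis elt_smult_def imageI smult_r_null)
  next
    fix x assume "x \<in> elt_smult M b N"
    then obtain n where n: "n \<in> N" "x = b \<odot>\<^bsub>M\<^esub> n"
      by (auto simp: elt_smult_def)
    have "\<ominus>\<^bsub>M\<^esub> x = b \<odot>\<^bsub>M\<^esub> (\<ominus>\<^bsub>M\<^esub> n)"
      using n b sub by (simp add: smult_r_minus)
    then show "\<ominus>\<^bsub>M\<^esub> x \<in> elt_smult M b N"
      using E(3) n by (auto simp: elt_smult_def)
  next
    fix x y assume "x \<in> elt_smult M b N" "y \<in> elt_smult M b N"
    then obtain n k where n: "n \<in> N" "x = b \<odot>\<^bsub>M\<^esub> n" "k \<in> N" "y = b \<odot>\<^bsub>M\<^esub> k"
      by (auto simp: elt_smult_def)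
    have "x \<oplus>\<^bsub>M\<^esub> y = b \<odot>\<^bsub>M\<^esub> (n \<oplus>\<^bsub>M\<^esub> k)"
      using n b sub by (simp add: smult_r_distr)
    then show "x \<oplus>\<^bsub>M\<^esub> y \<in> elt_smult M b N"
      using E(5) n by (auto simp: elt_smult_def)
  next
    fix r x assume r: "r \<in> carrier R" and "x \<in> elt_smult M b N"
    then obtain n where n: "n \<in> N" "x = b \<odot>\<^bsub>M\<^esub> n"
      by (auto simp: elt_smult_def)
    have "r \<odot>\<^bsub>M\<^esub> x = b \<odot>\<^bsub>M\<^esub> (r \<odot>\<^bsub>M\<^esub> n)"
      using n b r sub by (metis smult_assoc1 R.m_comm)
    then show "r \<odot>\<^bsub>M\<^esub> x \<in> elt_smult M b N"
      using E(4) n r by (auto simp: elt_smult_def)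
  qed
qed

text \<open>Both sides unfold to the same condition because \<open>(a r) m = a (r m)\<close>. With
  \<open>I\<close> the annihilator of the kernel of \<open>a\<close>, the right side is the value of
  \<open>psi1\<close> at that kernel.\<close>

lemma colon_l_coset_eq_colon_zero_colon_elt:
  assumes "a \<in> carrier R" "I \<subseteq> carrier R"
  shows "colon M {\<zero>\<^bsub>M\<^esub>} (a <#\<^bsub>R\<^esub> I) = colon M (zero_colon_elt M a) I"
  using assms by (fastforce simp: colon_def l_coset_def zero_colon_elt_def smult_assoc1)

text \<open>As \<open>a\<close> kills its own kernel, \<open>(a + b) n = a n + b n = b n\<close> for
  every \<open>n\<close> there.\<close>

lemma elt_smult_add_eq:
  assumes "a \<in> carrier R" "b \<in> carrier R"
  shows "elt_smult M (a \<oplus> b) (zero_colon_elt M a) = elt_smult M b (zero_colon_elt M a)"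
  unfolding elt_smult_def
  by (rule image_cong) (use assms in \<open>auto simp: zero_colon_elt_def smult_l_distr\<close>)

text \<open>For \<open>p\<close> in \<open>P\<close>, \<open>a p = (a + b) p - b p\<close> is a
  difference of two elements of \<open>K\<close>.\<close>

lemma elt_smult_subset_if_add:
  assumes a: "a \<in> carrier R" and b: "b \<in> carrier R" and P: "P \<subseteq> carrier M"
    and K: "submodule K R M"
    and "elt_smult M b P \<subseteq> K" "elt_smult M (a \<oplus> b) P \<subseteq> K"
  shows "elt_smult M a P \<subseteq> K"
proof -
  have "a \<odot>\<^bsub>M\<^esub> p \<in> K" if p: "p \<in> P" for p
  proof -
    have pc: "p \<in> carrier M" using p P by blast
    have "(a \<oplus> b) \<odot>\<^bsub>M\<^esub> p \<in> K" "\<ominus>\<^bsub>M\<^esub> (b \<odot>\<^bsub>M\<^esub> p) \<in> K"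
      using assms p submoduleE(3)[OF K] by (auto simp: elt_smult_def)
    then have "(a \<oplus> b) \<odot>\<^bsub>M\<^esub> p \<oplus>\<^bsub>M\<^esub> \<ominus>\<^bsub>M\<^esub> (b \<odot>\<^bsub>M\<^esub> p) \<in> K"
      by (rule submoduleE(5)[OF K])
    also have "(a \<oplus> b) \<odot>\<^bsub>M\<^esub> p \<oplus>\<^bsub>M\<^esub> \<ominus>\<^bsub>M\<^esub> (b \<odot>\<^bsub>M\<^esub> p) = a \<odot>\<^bsub>M\<^esub> p"
      using a b pc by (simp add: smult_l_distr M.a_assoc M.r_neg)
    finally show ?thesis .
  qed
  then show ?thesis by (auto simp: elt_smult_def)
qed

end

theorem theorem2p15:
  fixes R :: "('a, 'r) ring_scheme" and M :: "('a, 'b, 'm) module_scheme" and a :: 'a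
  assumes "module R M" and "a \<in> carrier R"
    and "zero_colon_elt M a \<subseteq>
           elt_smult M a (colon M {\<zero>\<^bsub>M\<^esub>} (a <#\<^bsub>R\<^esub> Ann R M (zero_colon_elt M a)))"
    and "psi_second R M (psi1 R M) (zero_colon_elt M a)"
  shows "second_submodule R M (zero_colon_elt M a)"
proof -
  interpret module R M by fact
  note a = \<open>a \<in> carrier R\<close>
  define N where "N = zero_colon_elt M a"
  define P where "P = psi1 R M N"
  have N: "submodule N R M" "N \<noteq> {\<zero>\<^bsub>M\<^esub>}"
    using assms(4) unfolding psi_second_def N_def by blast+
  have psi: "N \<subseteq> K \<or> elt_smult M r N = {\<zero>\<^bsub>M\<^esub>}"
      if "r \<in> carrier R" "submodule K R M" "elt_smult M r N \<subseteq> K" "\<not> elt_smult M r P \<subseteq> K" for r K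
    using assms(4) that unfolding psi_second_def N_def P_def by blast
  have "Ann R M N \<subseteq> carrier R"
    by (auto simp: Ann_def)
  \<comment> \<open>The inclusion just shown is the side condition for rewriting the colon in the
    hypothesis to \<open>P\<close>.\<close>
  then have NP: "N \<subseteq> elt_smult M a P"
    using assms(3) a
    by (simp add: N_def P_def psi1_def colon_l_coset_eq_colon_zero_colon_elt)
  have P: "P \<subseteq> carrier M"
    by (auto simp: P_def psi1_def colon_def)
  have "elt_smult M b N = N \<or> elt_smult M b N = {\<zero>\<^bsub>M\<^esub>}" if b: "b \<in> carrier R" for b
  proof -
    let ?K = "elt_smult M b N"
    have K: "submodule ?K R M"
      using N(1) b by (rule submodule_elt_smult)
    have ab: "elt_smult M (a \<oplus>\<^bsub>R\<^esub> b) N = ?K"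
      unfolding N_def using a b by (rule elt_smult_add_eq)
    have "N \<subseteq> ?K \<or> ?K = {\<zero>\<^bsub>M\<^esub>}"
    proof (cases "elt_smult M b P \<subseteq> ?K \<and> elt_smult M (a \<oplus>\<^bsub>R\<^esub> b) P \<subseteq> ?K")
      case True
      then show ?thesis
        \<comment> \<open>Here \<open>N \<subseteq> a P \<subseteq> b N\<close>.\<close>
        using elt_smult_subset_if_add[OF a b P K] NP by blast
    next
      case False
      then show ?thesis
        \<comment> \<open>One of \<open>b\<close> and \<open>a + b\<close> does not send
          \<open>P\<close> into \<open>b N\<close>. Both have image \<open>b N\<close> on
          \<open>N\<close>, so by \<open>ab\<close> either choice yields the same
          disjunction.\<close>
        using psi[OF b K] psi[of "a \<oplus>\<^bsub>R\<^esub> b", OF _ K] a b ab by auto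
    qed
    moreover have "?K \<subseteq> N"
      using submoduleE(4)[OF N(1) b] by (auto simp: elt_smult_def)
    ultimately show ?thesis by blast
  qed
  then show ?thesis
    using N unfolding second_submodule_def N_def by blast
qed

end
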